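(* Let $\xi\ge0$ a.s. Then, for any $a>0$ and $t\in\mathbb{R}$, $\mathbb{E}e^{aZ(t)}<\infty$ holds if and only if $$r(t):=\int\Big(\mathbb{E}e^{aX(t-y)}-1\Big)\,\mathbb{U}(dy)<\infty\quad\text{and}\quad l(t):=\mathbb{E}\Big(\prod_{n=1}^{\tau^*}e^{aX_n(t-S_{n-1})}\Big)<\infty.$$ Moreover, $r(t)<\infty$ alone implies $\mathbb{E}e^{aZ(t_0)}<\infty$ for some $t_0\le t$.
   Context: Let $\xi$ be a real-valued random variable with $\mathbb{P}\{\xi=0\}<1$ and let $(X(t))_{t\in\mathbb{R}}$ be a nonnegative (finite-valued) stochastic process with nondecreasing paths such that $\lim_{t\to-\infty}X(t)=0$ a.s. Any dependence between $(X(t))_{t\in\mathbb{R}}$ and $\xi$ is allowed. Let $((X_n(t))_{t\in\mathbb{R}},\xi_n)_{n\ge1}$ be a sequence of independent copies of $((X(t))_{t\in\mathbb{R}},\xi)$. Put $S_0:=0$, $S_n:=\xi_1+\cdots+\xi_n$ for $n\in\mathbb{N}$, and define the renewal shot-noise process $Z(t):=\sum_{n\ge1}X_n(t-S_{n-1})$, $t\in\mathbb{R}$. Let $\tau^*:=\inf\{n\ge1:S_n>0\}$ and let $\mathbb{U}:=\sum_{n\ge0}\mathbb{P}\{S_n\in\cdot\}$ be the renewal measure of $(S_n)_{n\ge0}$. *)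

theory Defs
  imports "HOL-Probability.Probability"
begin

text \<open>
  A path is an element of the product space of copies of the real line indexed by real times;
  a process together with its step variable is a random element of the following space.
\<close>

definition path_step_space :: "((real \<Rightarrow> real) \<times> real) measure" where
  "path_step_space = (\<Pi>\<^sub>M t\<in>(UNIV :: real set). borel) \<Otimes>\<^sub>M borel"

text \<open>
  The pair \<open>(X, \<xi>)\<close> is the generic pair and \<open>(X' n, \<xi>' n)\<close>, \<open>n \<ge> 1\<close>, are its independent copies; the
  index \<open>0\<close> is not used. Processes take the time first and the sample point second. Nonnegativity
  and monotonicity of the paths are required of the copies as well, because equality of laws on
  the product sigma-algebra, whose events depend on countably many times only, does not transfer
  them. No regularity of the paths is assumed beyond monotonicity, and none is needed for the
  expectations below to make sense: \<open>X' n\<close> is independent of the preceding steps and has monotone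
  paths, so \<open>X' n\<close> evaluated at the random time \<open>t - S (n - 1)\<close> coincides almost surely with a
  random variable, which determines its \<open>nn_integral\<close>.
\<close>

locale renewal_shot_noise = prob_space M for M :: "'a measure" +
  fixes X :: "real \<Rightarrow> 'a \<Rightarrow> real" and \<xi> :: "'a \<Rightarrow> real"
    and X' :: "nat \<Rightarrow> real \<Rightarrow> 'a \<Rightarrow> real" and \<xi>' :: "nat \<Rightarrow> 'a \<Rightarrow> real"
  assumes step_measurable: "random_variable borel \<xi>"
    and step_nontrivial: "prob {\<omega> \<in> space M. \<xi> \<omega> = 0} < 1"
    and process_measurable: "\<And>t. random_variable borel (X t)"
    and process_nonneg: "\<And>t \<omega>. \<omega> \<in> space M \<Longrightarrow> 0 \<le> X t \<omega>"
    and process_mono: "\<And>\<omega>. \<omega> \<in> space M \<Longrightarrow> mono (\<lambda>t. X t \<omega>)"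
    and process_limit: "AE \<omega> in M. ((\<lambda>t. X t \<omega>) \<longlongrightarrow> 0) at_bot"
    and copies_nonneg: "\<And>n t \<omega>. n \<ge> 1 \<Longrightarrow> \<omega> \<in> space M \<Longrightarrow> 0 \<le> X' n t \<omega>"
    and copies_mono: "\<And>n \<omega>. n \<ge> 1 \<Longrightarrow> \<omega> \<in> space M \<Longrightarrow> mono (\<lambda>t. X' n t \<omega>)"
    and copies_indep:
      "indep_vars (\<lambda>_. path_step_space) (\<lambda>n \<omega>. (\<lambda>t. X' n t \<omega>, \<xi>' n \<omega>)) {1..}"
    and copies_distr: "\<And>n. n \<ge> 1 \<Longrightarrow>
      distr M path_step_space (\<lambda>\<omega>. (\<lambda>t. X' n t \<omega>, \<xi>' n \<omega>)) =
      distr M path_step_space (\<lambda>\<omega>. (\<lambda>t. X t \<omega>, \<xi> \<omega>))"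

definition walk :: "(nat \<Rightarrow> 'a \<Rightarrow> real) \<Rightarrow> nat \<Rightarrow> 'a \<Rightarrow> real" where
  "walk \<xi>' n \<omega> = (\<Sum>k=1..n. \<xi>' k \<omega>)"

text \<open>The series may diverge, so the shot noise takes values in \<open>[0, \<infinity>]\<close>.\<close>

definition shot_noise ::
    "(nat \<Rightarrow> real \<Rightarrow> 'a \<Rightarrow> real) \<Rightarrow> (nat \<Rightarrow> 'a \<Rightarrow> real) \<Rightarrow> real \<Rightarrow> 'a \<Rightarrow> ennreal" where
  "shot_noise X' \<xi>' t \<omega> = (\<Sum>n. ennreal (X' (Suc n) (t - walk \<xi>' n \<omega>) \<omega>))"

definition exp_ennreal :: "ennreal \<Rightarrow> ennreal" where
  "exp_ennreal x = (if x = \<infinity> then \<infinity> else ennreal (exp (enn2real x)))"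

definition first_ascent :: "(nat \<Rightarrow> 'a \<Rightarrow> real) \<Rightarrow> 'a \<Rightarrow> enat" where
  "first_ascent \<xi>' \<omega> = Inf (enat ` {n. n \<ge> 1 \<and> walk \<xi>' n \<omega> > 0})"

definition renewal_measure :: "'a measure \<Rightarrow> (nat \<Rightarrow> 'a \<Rightarrow> real) \<Rightarrow> real measure" where
  "renewal_measure M \<xi>' =
    measure_of UNIV (sets borel) (\<lambda>A. \<Sum>n. emeasure M {\<omega> \<in> space M. walk \<xi>' n \<omega> \<in> A})"

text \<open>The difference is the true one: \<open>X\<close> is nonnegative, so the expectation is at least \<open>1\<close>.\<close>

definition r_fun ::
    "'a measure \<Rightarrow> (real \<Rightarrow> 'a \<Rightarrow> real) \<Rightarrow> (nat \<Rightarrow> 'a \<Rightarrow> real) \<Rightarrow> real \<Rightarrow> real \<Rightarrow> ennreal" where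
  "r_fun M X \<xi>' a t =
    (\<integral>\<^sup>+ y. ((\<integral>\<^sup>+ \<omega>. ennreal (exp (a * X (t - y) \<omega>)) \<partial>M) - 1) \<partial>renewal_measure M \<xi>')"

text \<open>
  If the first ascent is infinite, the index set is infinite and the product is \<open>1\<close> by convention.
  For nonnegative steps that are not almost surely zero this concerns a null set only.
\<close>

definition l_fun ::
    "'a measure \<Rightarrow> (nat \<Rightarrow> real \<Rightarrow> 'a \<Rightarrow> real) \<Rightarrow> (nat \<Rightarrow> 'a \<Rightarrow> real) \<Rightarrow> real \<Rightarrow> real \<Rightarrow> ennreal"
  where
  "l_fun M X' \<xi>' a t =
    (\<integral>\<^sup>+ \<omega>. (\<Prod>n\<in>{n. 1 \<le> n \<and> enat n \<le> first_ascent \<xi>' \<omega>}.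
        ennreal (exp (a * X' n (t - walk \<xi>' (n - 1) \<omega>) \<omega>))) \<partial>M)"

context renewal_shot_noise
begin

lemma copies_step_measurable:
  assumes "n \<ge> 1"
  shows "random_variable borel (\<xi>' n)"
proof -
  have "(\<lambda>\<omega>. (\<lambda>t. X' n t \<omega>, \<xi>' n \<omega>)) \<in> measurable M path_step_space"
    using copies_indep assms by (auto simp: indep_vars_def)
  from measurable_compose[OF this[unfolded path_step_space_def] measurable_snd]
  show ?thesis by simp
qed

lemma walk_measurable: "random_variable borel (walk \<xi>' n)"
  unfolding walk_def [abs_def] by (intro borel_measurable_sum copies_step_measurable) auto

lemma sets_renewal_measure: "sets (renewal_measure M \<xi>') = sets borel"
  unfolding renewal_measure_def using sets.sigma_sets_eq[of "borel :: real measure"] by simp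

lemma emeasure_renewal_measure:
  assumes "A \<in> sets borel"
  shows "emeasure (renewal_measure M \<xi>') A =
    (\<Sum>n. emeasure M {\<omega> \<in> space M. walk \<xi>' n \<omega> \<in> A})"
proof -
  have distr: "emeasure M {\<omega> \<in> space M. walk \<xi>' n \<omega> \<in> B} = emeasure (distr M borel (walk \<xi>' n)) B"
    if "B \<in> sets borel" for n B
    using that walk_measurable by (subst emeasure_distr) (auto intro!: arg_cong[where f = "emeasure M"])
  have "countably_additive (sets borel)
      (\<lambda>A. \<Sum>n. emeasure M {\<omega> \<in> space M. walk \<xi>' n \<omega> \<in> A})"
  proof (rule countably_additiveI)
    fix B :: "nat \<Rightarrow> real set"
    assume B: "range B \<subseteq> sets borel" "disjoint_family B" "(\<Union>i. B i) \<in> sets borel"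
    have "(\<Sum>i. \<Sum>n. emeasure (distr M borel (walk \<xi>' n)) (B i)) =
        (\<Sum>n. \<Sum>i. emeasure (distr M borel (walk \<xi>' n)) (B i))"
      using nn_integral_suminf[of "\<lambda>i n. emeasure (distr M borel (walk \<xi>' n)) (B i)"
          "count_space UNIV"]
      by (simp add: nn_integral_count_space_nat)
    also have "\<dots> = (\<Sum>n. emeasure (distr M borel (walk \<xi>' n)) (\<Union>i. B i))"
      using B by (intro suminf_cong suminf_emeasure) auto
    finally show "(\<Sum>i. \<Sum>n. emeasure M {\<omega> \<in> space M. walk \<xi>' n \<omega> \<in> B i}) =
        (\<Sum>n. emeasure M {\<omega> \<in> space M. walk \<xi>' n \<omega> \<in> (\<Union>i. B i)})"
      by (simp only: distr[OF B(3)] distr[OF range_subsetD[OF B(1)]])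
  qed
  moreover have "positive (sets borel) (\<lambda>A. \<Sum>n. emeasure M {\<omega> \<in> space M. walk \<xi>' n \<omega> \<in> A})"
    by (simp add: positive_def)
  ultimately show ?thesis
    using assms
    by (subst emeasure_measure_of[OF renewal_measure_def])
       (simp_all add: sets_renewal_measure)
qed

end

end

theory Submission
  imports Defs
begin

text \<open>
  Let \<open>u\<^sub>n(s)\<close> be the exponential moment of the first \<open>n\<close> shots seen from time \<open>s\<close>. Conditioning on the
  first pair gives \<open>u\<^sub>n\<^sub>+\<^sub>1(s) = E[exp(a X(s)) u\<^sub>n(s - \<xi>)]\<close>. Expanding the product of the factors
  \<open>1 + (exp(a X\<^sub>k) - 1)\<close> yields \<open>1 + r(s) \<le> sup u\<^sub>n(s)\<close>, and, since \<open>u\<^sub>n\<close> is nondecreasing in \<open>s\<close> and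
  \<open>\<xi> \<ge> 0\<close>, also \<open>u\<^sub>n\<^sub>+\<^sub>1(s) \<le> 1 + r(s) u\<^sub>n(s)\<close>, so that the moments stay bounded as soon as \<open>r(s) < 1\<close>;
  by dominated convergence this holds far enough to the left whenever \<open>r(t)\<close> is finite.
  Finiteness of \<open>l(t)\<close>, a geometric series with ratio \<open>E[exp(a X(t)); \<xi> = 0]\<close>, forces this ratio to be
  less than \<open>1\<close>. Then \<open>q = E[exp(a X(t)); \<xi> \<le> \<delta>] < 1\<close> for some \<open>\<delta> > 0\<close>, and
  \<open>u\<^sub>n\<^sub>+\<^sub>1(s) \<le> q u\<^sub>n(s) + E[exp(a X(t))] u\<^sub>n(s - \<delta>)\<close> for \<open>s \<le> t\<close> carries finiteness to the right in
  steps of length \<open>\<delta>\<close> up to \<open>t\<close>.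
\<close>

section \<open>Extended nonnegative arithmetic and exponentials of series\<close>

text \<open>The map taking \<open>B\<close> to \<open>K + q * B\<close> has the fixed point
  \<open>K / (1 - q)\<close> and preserves every bound above it. Recursive estimates with ratio
  below \<open>1\<close> thereby become uniform bounds by induction; \<open>1 \<le> B\<close>
  provides the initial case.\<close>

lemma ennreal_affine_invariant_bound:
  fixes q K :: ennreal
  assumes "q < 1" "K < \<infinity>"
  obtains B where "1 \<le> B" "B < \<infinity>" "K + q * B \<le> B"
proof -
  obtain q' where q': "q = ennreal q'" "0 \<le> q'" "q' < 1"
    using assms(1) by (cases q) auto
  obtain K' where K': "K = ennreal K'" "0 \<le> K'"
    using assms(2) by (cases K) auto
  define b where "b = max 1 (K' / (1 - q'))"
  have "K' \<le> (1 - q') * b"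
    using q'(3) mult_left_mono[of "K' / (1 - q')" b "1 - q'"] by (simp add: b_def)
  then have "K' + q' * b \<le> b"
    by (simp add: algebra_simps)
  moreover have "1 \<le> b"
    by (simp add: b_def)
  ultimately have "K + q * ennreal b \<le> ennreal b"
    using q' K' by (simp add: ennreal_mult[symmetric] ennreal_plus[symmetric] del: ennreal_plus)
  with \<open>1 \<le> b\<close> show thesis
    by (intro that[of "ennreal b"]) auto
qed

lemma ennreal_inverse_antimono:
  fixes x y :: ennreal
  assumes "x \<le> y"
  shows "inverse y \<le> inverse x"
proof (cases "x = 0 \<or> y = top")
  case False
  then obtain r r' where "x = ennreal r" "0 < r" "y = ennreal r'"
    using assms by (cases x; cases y) (auto simp: le_less top_unique)
  moreover from this assms False have "r \<le> r'"
    by (cases "0 \<le> r'") (auto simp: ennreal_neg)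
  ultimately show ?thesis
    by (simp add: inverse_ennreal ennreal_leI le_imp_inverse_le)
qed auto

lemma ennreal_inverse_inverse [simp]: "inverse (inverse x) = (x :: ennreal)"
  by (cases x) (auto simp: inverse_ennreal le_less)

lemma prod_mono_ennreal:
  fixes f g :: "'b \<Rightarrow> ennreal"
  shows "(\<And>k. k \<in> A \<Longrightarrow> f k \<le> g k) \<Longrightarrow> prod f A \<le> prod g A"
  by (induction A rule: infinite_finite_induct) (auto intro: mult_mono)

text \<open>Continuity of \<open>exp\<close> settles the summable case; in the divergent case
  \<open>exp y \<ge> y\<close> makes the products unbounded. Finite products prepare for monotone
  convergence.\<close>

lemma exp_ennreal_suminf:
  fixes x :: "nat \<Rightarrow> real"
  assumes nonneg: "\<And>k. 0 \<le> x k"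
  shows "exp_ennreal (\<Sum>k. ennreal (x k)) = (SUP n. \<Prod>k<n. ennreal (exp (x k)))"
proof -
  have prod: "(\<Prod>k<n. ennreal (exp (x k))) = ennreal (exp (\<Sum>k<n. x k))" for n
    by (simp add: prod_ennreal exp_sum)
  show ?thesis
  proof (cases "summable x")
    case True
    have "incseq (\<lambda>n. ennreal (exp (\<Sum>k<n. x k)))"
      by (intro incseq_SucI ennreal_leI) (simp add: nonneg)
    then have "(\<lambda>n. ennreal (exp (\<Sum>k<n. x k))) \<longlonglongrightarrow> (SUP n. ennreal (exp (\<Sum>k<n. x k)))"
      by (rule LIMSEQ_SUP)
    moreover have "(\<lambda>n. ennreal (exp (\<Sum>k<n. x k))) \<longlonglongrightarrow> ennreal (exp (suminf x))"
      using summable_LIMSEQ[OF True] by (intro tendsto_ennrealI tendsto_exp)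
    ultimately have "(SUP n. ennreal (exp (\<Sum>k<n. x k))) = ennreal (exp (suminf x))"
      by (rule LIMSEQ_unique)
    then show ?thesis
      by (simp add: prod suminf_ennreal2[OF nonneg True] exp_ennreal_def suminf_nonneg[OF True nonneg])
  next
    case False
    then have top: "(\<Sum>k. ennreal (x k)) = top"
      using summable_suminf_not_top[of x] nonneg by blast
    have "(\<Sum>k. ennreal (x k)) \<le> (SUP n. ennreal (exp (\<Sum>k<n. x k)))"
      unfolding suminf_eq_SUP
    proof (rule SUP_mono)
      fix n
      have "(\<Sum>k<n. x k) \<le> exp (\<Sum>k<n. x k)"
        using exp_ge_add_one_self[of "\<Sum>k<n. x k"] by linarith
      then show "\<exists>m\<in>UNIV. (\<Sum>k<n. ennreal (x k)) \<le> ennreal (exp (\<Sum>k<m. x k))"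
        by (intro bexI[of _ n]) (auto simp: sum_ennreal nonneg intro: ennreal_leI)
    qed
    then have "(SUP n. ennreal (exp (\<Sum>k<n. x k))) = top"
      unfolding top by (rule top_le)
    then show ?thesis
      unfolding prod top by (simp only: exp_ennreal_def infinity_ennreal_def if_True simp_thms)
  qed
qed

section \<open>Exponential moments for a jointly measurable factor\<close>

text \<open>Abstracts the generic pair: \<open>e x s\<close> plays the role of exp(a X(s)) and
  \<open>\<sigma> x\<close> that of the step. Both are functions of the same \<open>x\<close>, so
  any dependence is allowed. Joint measurability permits evaluation at random times.\<close>

locale multiplicative_shot = prob_space N for N :: "'b measure" +
  fixes e :: "'b \<Rightarrow> real \<Rightarrow> ennreal" and \<sigma> :: "'b \<Rightarrow> real"
  assumes factor_measurable: "(\<lambda>(x, s). e x s) \<in> borel_measurable (N \<Otimes>\<^sub>M borel)"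
    and factor_ge_1: "1 \<le> e x s"
    and factor_mono: "s \<le> s' \<Longrightarrow> e x s \<le> e x s'"
    and shift_measurable [measurable]: "\<sigma> \<in> borel_measurable N"
    and shift_nonneg: "AE x in N. 0 \<le> \<sigma> x"
begin

lemma factor_measurable' [measurable (raw)]:
  assumes [measurable]: "f \<in> measurable L N" "g \<in> borel_measurable L"
  shows "(\<lambda>x. e (f x) (g x)) \<in> borel_measurable L"
  using measurable_compose[OF _ factor_measurable, of "\<lambda>x. (f x, g x)" L] by simp

text \<open>Conditioning on the first pair is built into the recursion;
  \<open>nn_integral_sequence_prod\<close> recovers the expectation of the product of the first
  \<open>n\<close> factors.\<close>

primrec moment :: "nat \<Rightarrow> real \<Rightarrow> ennreal" where
  "moment 0 s = 1"
| "moment (Suc n) s = (\<integral>\<^sup>+ x. e x s * moment n (s - \<sigma> x) \<partial>N)"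

text \<open>The mean of \<open>g\<close> at \<open>s\<close> minus the position after
  \<open>n\<close> steps. Summed over \<open>n\<close>, it integrates \<open>g (s - y)\<close>
  against the renewal measure.\<close>

primrec shifted_mean :: "(real \<Rightarrow> ennreal) \<Rightarrow> nat \<Rightarrow> real \<Rightarrow> ennreal" where
  "shifted_mean g 0 s = g s"
| "shifted_mean g (Suc n) s = (\<integral>\<^sup>+ x. shifted_mean g n (s - \<sigma> x) \<partial>N)"

definition excess :: "real \<Rightarrow> ennreal" where
  "excess s = (\<integral>\<^sup>+ x. e x s \<partial>N) - 1"

definition total_moment :: "real \<Rightarrow> ennreal" where
  "total_moment s = (SUP n. moment n s)"

section \<open>Monotonicity and bounds of the moments\<close>

lemma moment_measurable [measurable]: "moment n \<in> borel_measurable borel"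
  by (induction n) simp_all

lemma shifted_mean_measurable:
  "g \<in> borel_measurable borel \<Longrightarrow> shifted_mean g n \<in> borel_measurable borel"
proof (induction n)
  case (Suc n)
  then have [measurable]: "shifted_mean g n \<in> borel_measurable borel" by simp
  show ?case by simp
qed (simp cong: measurable_cong)

lemma excess_measurable [measurable]: "excess \<in> borel_measurable borel"
  unfolding excess_def by simp

declare emeasure_space_1 [simp]

lemma mean_factor_ge_1: "1 \<le> (\<integral>\<^sup>+ x. e x s \<partial>N)"
  using nn_integral_mono[of N "\<lambda>_. 1" "\<lambda>x. e x s"] factor_ge_1 by simp

lemma mean_factor_eq: "(\<integral>\<^sup>+ x. e x s \<partial>N) = 1 + excess s"
  unfolding excess_def by (simp add: mean_factor_ge_1 add_diff_inverse_ennreal)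

lemma nn_integral_factor_minus_1: "(\<integral>\<^sup>+ x. e x s - 1 \<partial>N) = excess s"
  unfolding excess_def by (subst nn_integral_diff) (auto simp: factor_ge_1)

lemma moment_ge_1: "1 \<le> moment n s"
proof (induction n arbitrary: s)
  case (Suc n)
  have "(\<integral>\<^sup>+ x. 1 \<partial>N) \<le> moment (Suc n) s"
    unfolding moment.simps
    by (intro nn_integral_mono) (use mult_mono[OF factor_ge_1 Suc] in auto)
  then show ?case by simp
qed simp

lemma moment_mono: "s \<le> s' \<Longrightarrow> moment n s \<le> moment n s'"
proof (induction n arbitrary: s s')
  case (Suc n)
  then show ?case
    by (auto intro!: nn_integral_mono mult_mono factor_mono)
qed simp

lemma moment_Suc_ge: "moment n s \<le> moment (Suc n) s"
proof (induction n arbitrary: s)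
  case 0
  show ?case using moment_ge_1[of 1 s] by simp
next
  case (Suc n)
  then show ?case
    unfolding moment.simps(2)[of "Suc n"] moment.simps(2)[of n]
    by (intro nn_integral_mono mult_mono) auto
qed

lemma total_moment_mono: "s \<le> s' \<Longrightarrow> total_moment s \<le> total_moment s'"
  unfolding total_moment_def by (intro SUP_mono) (blast intro: moment_mono)

lemma moment_le_total: "moment n s \<le> total_moment s"
  unfolding total_moment_def by (rule SUP_upper) simp

text \<open>Writing \<open>e\<close> as \<open>(e - 1) + 1\<close> is legitimate, also for infinite
  values, because \<open>1 \<le> e\<close>. Both bounds on the moments start from this
  split.\<close>

lemma moment_Suc_split:
  "moment (Suc n) s =
    (\<integral>\<^sup>+ x. (e x s - 1) * moment n (s - \<sigma> x) \<partial>N) + (\<integral>\<^sup>+ x. moment n (s - \<sigma> x) \<partial>N)"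
proof -
  have "e x s * y = (e x s - 1) * y + y" for x y
    using distrib_right[of "e x s - 1" 1 y] by (simp add: factor_ge_1 diff_add_cancel_ennreal)
  then show ?thesis
    by (simp add: nn_integral_add)
qed

text \<open>First-step decomposition: the discrete renewal equation for the truncated potential of
  \<open>g\<close>.\<close>

lemma sum_shifted_mean_Suc:
  assumes [measurable]: "g \<in> borel_measurable borel"
  shows "(\<Sum>k<Suc n. shifted_mean g k s) =
    g s + (\<integral>\<^sup>+ x. (\<Sum>k<n. shifted_mean g k (s - \<sigma> x)) \<partial>N)"
proof -
  have [measurable]: "shifted_mean g k \<in> borel_measurable borel" for k
    using assms by (rule shifted_mean_measurable)
  show ?thesis
    by (subst sum.lessThan_Suc_shift) (simp add: nn_integral_sum)
qed

text \<open>In the expansion of the product of the factors \<open>1 + (e - 1)\<close>, only the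
  terms with at most one excess are kept; in the induction the later moment next to an excess is
  replaced by \<open>1\<close>.\<close>

lemma moment_lower_bound: "1 + (\<Sum>k<n. shifted_mean excess k s) \<le> moment n s"
proof (induction n arbitrary: s)
  case (Suc n)
  have [measurable]: "shifted_mean excess k \<in> borel_measurable borel" for k
    by (simp add: shifted_mean_measurable)
  have "1 + (\<Sum>k<Suc n. shifted_mean excess k s) =
      (\<integral>\<^sup>+ x. e x s - 1 \<partial>N) + (\<integral>\<^sup>+ x. 1 + (\<Sum>k<n. shifted_mean excess k (s - \<sigma> x)) \<partial>N)"
    by (simp add: sum_shifted_mean_Suc nn_integral_factor_minus_1 nn_integral_add ac_simps
        del: sum.lessThan_Suc)
  also have "\<dots> \<le> moment (Suc n) s"
    unfolding moment_Suc_split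
  proof (intro add_mono nn_integral_mono Suc)
    fix x
    show "e x s - 1 \<le> (e x s - 1) * moment n (s - \<sigma> x)"
      using mult_left_mono[OF moment_ge_1, of "e x s - 1"] by simp
  qed
  finally show ?case .
qed simp

text \<open>A product of factors exceeds \<open>1\<close> by the sum, over all positions, of the
  excess there times the product of the later factors. As steps are nonnegative, the later factors
  are seen from a time not after \<open>s\<close>; bounding their moment by the one at
  \<open>s\<close> also removes the dependence on the step that accompanies the excess.\<close>

lemma moment_upper_bound:
  "moment (Suc n) s \<le> 1 + (\<Sum>k<Suc n. shifted_mean excess k s) * moment n s"
proof (induction n arbitrary: s)
  case 0
  show ?case by (simp add: mean_factor_eq)
next
  case (Suc n)
  have [measurable]: "shifted_mean excess k \<in> borel_measurable borel" for k
    by (simp add: shifted_mean_measurable)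
  let ?R = "\<lambda>s. \<Sum>k<Suc n. shifted_mean excess k s"
  have "moment (Suc (Suc n)) s \<le> (\<integral>\<^sup>+ x. (e x s - 1) * moment (Suc n) s \<partial>N) +
      (\<integral>\<^sup>+ x. 1 + ?R (s - \<sigma> x) * moment (Suc n) s \<partial>N)"
    unfolding moment_Suc_split[of "Suc n"]
  proof (intro add_mono nn_integral_mono_AE)
    show "AE x in N. (e x s - 1) * moment (Suc n) (s - \<sigma> x) \<le> (e x s - 1) * moment (Suc n) s"
      using shift_nonneg by eventually_elim (intro mult_left_mono moment_mono, auto)
    show "AE x in N. moment (Suc n) (s - \<sigma> x) \<le> 1 + ?R (s - \<sigma> x) * moment (Suc n) s"
      using shift_nonneg
    proof eventually_elim
      case (elim x)
      \<comment> \<open>The moment multiplying \<open>?R\<close> in the induction hypothesis depends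
        on \<open>x\<close>; it is raised to a constant that can leave the integral.\<close>
      have "moment n (s - \<sigma> x) \<le> moment (Suc n) s"
        by (rule order_trans[OF moment_Suc_ge moment_mono]) (use elim in simp)
      then have "?R (s - \<sigma> x) * moment n (s - \<sigma> x) \<le> ?R (s - \<sigma> x) * moment (Suc n) s"
        by (intro mult_left_mono) auto
      with Suc[of "s - \<sigma> x"] show ?case
        by (meson add_left_mono order_trans)
    qed
  qed
  also have "\<dots> = 1 + (excess s + (\<integral>\<^sup>+ x. ?R (s - \<sigma> x) \<partial>N)) * moment (Suc n) s"
    by (simp add: nn_integral_add nn_integral_multc nn_integral_factor_minus_1 distrib_right
        add.left_commute del: sum.lessThan_Suc moment.simps)
  also have "excess s + (\<integral>\<^sup>+ x. ?R (s - \<sigma> x) \<partial>N) = (\<Sum>k<Suc (Suc n). shifted_mean excess k s)"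
    by (rule sum_shifted_mean_Suc[symmetric]) simp
  finally show ?case .
qed

lemma suminf_excess_le_total: "1 + (\<Sum>k. shifted_mean excess k s) \<le> total_moment s"
proof -
  have "1 + (\<Sum>k. shifted_mean excess k s) = (SUP n. 1 + (\<Sum>k<n. shifted_mean excess k s))"
    by (subst suminf_eq_SUP) (simp add: ennreal_SUP_add_right)
  also have "\<dots> \<le> total_moment s"
    unfolding total_moment_def by (intro SUP_mono) (blast intro: moment_lower_bound)
  finally show ?thesis .
qed

text \<open>The upper bound turns into an affine recursion with ratio \<open>?R\<close> below
  \<open>1\<close>, whose invariant bound \<open>B\<close> holds for all \<open>n\<close> at
  once.\<close>

lemma total_moment_finite_if_small:
  assumes "(\<Sum>k. shifted_mean excess k s) < 1"
  shows "total_moment s < \<infinity>"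
proof -
  let ?R = "\<Sum>k. shifted_mean excess k s"
  obtain B where B: "1 \<le> B" "B < \<infinity>" "1 + ?R * B \<le> B"
    using ennreal_affine_invariant_bound[OF assms, of 1] by auto
  have "moment n s \<le> B" for n
  proof (induction n)
    case (Suc n)
    have "moment (Suc n) s \<le> 1 + (\<Sum>k<Suc n. shifted_mean excess k s) * moment n s"
      by (rule moment_upper_bound)
    also have "\<dots> \<le> 1 + ?R * B"
      by (intro add_left_mono mult_mono Suc sum_le_suminf) auto
    finally show ?case using B(3) by (rule order_trans)
  qed (use B in simp)
  then have "total_moment s \<le> B"
    unfolding total_moment_def by (intro SUP_least)
  with B show ?thesis by (simp add: order_le_less_trans)
qed

text \<open>A first step above \<delta> leaves a moment known to be finite at distance \<delta> to
  the left; a smaller step costs only the ratio \<open>?q\<close>, which is below \<open>1\<close>.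
  Finitely many strides of length \<delta> then reach \<open>t\<close>.\<close>

lemma total_moment_finite_extend:
  assumes finite_mean: "(\<integral>\<^sup>+ x. e x t \<partial>N) < \<infinity>"
    and small: "(\<integral>\<^sup>+ x. e x t * indicator {x. \<sigma> x = 0} x \<partial>N) < 1"
    and finite: "total_moment t\<^sub>0 < \<infinity>"
  shows "total_moment t < \<infinity>"
proof -
  \<comment> \<open>These events decrease to \<open>\<sigma> x \<le> 0\<close>, almost everywhere
    the event \<open>\<sigma> x = 0\<close>. The finite mean allows monotone convergence from above,
    so some positive threshold keeps the integral below \<open>1\<close>.\<close>
  let ?f = "\<lambda>i x. e x t * indicator {x. \<sigma> x \<le> inverse (real (Suc i))} x"
  have lim: "(INF i. ?f i x) = e x t * indicator {x. \<sigma> x \<le> 0} x" for x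
  proof (cases "\<sigma> x \<le> 0")
    case True
    then have "\<sigma> x \<le> inverse (real (Suc i))" for i
      using order_trans[of "\<sigma> x" 0 "inverse (real (Suc i))"] by simp
    then show ?thesis using True by simp
  next
    case False
    then obtain i where "inverse (real (Suc i)) < \<sigma> x"
      using reals_Archimedean[of "\<sigma> x"] unfolding not_le by blast
    then have "?f i x = 0" by (simp add: not_le del: of_nat_Suc)
    moreover have "(INF i. ?f i x) \<le> ?f i x"
      by (rule INF_lower) simp
    ultimately have "(INF i. ?f i x) = 0"
      by (metis le_zero_eq)
    then show ?thesis using False by (simp del: of_nat_Suc)
  qed
  have "(\<integral>\<^sup>+ x. e x t * indicator {x. \<sigma> x = 0} x \<partial>N) = (\<integral>\<^sup>+ x. (INF i. ?f i x) \<partial>N)"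
    unfolding lim using shift_nonneg
    by (intro nn_integral_cong_AE) (auto elim: eventually_mono split: split_indicator)
  also have "\<dots> = (INF i. \<integral>\<^sup>+ x. ?f i x \<partial>N)"
  proof (rule nn_integral_monotone_convergence_INF_AE')
    show "AE x in N. ?f (Suc i) x \<le> ?f i x" for i
    proof (intro AE_I2 mult_left_mono)
      fix x
      have "inverse (real (Suc (Suc i))) \<le> inverse (real (Suc i))"
        by (rule le_imp_inverse_le) auto
      then show "indicator {x. \<sigma> x \<le> inverse (real (Suc (Suc i)))} x \<le>
          (indicator {x. \<sigma> x \<le> inverse (real (Suc i))} x :: ennreal)"
        by (metis indicator_leI mem_Collect_eq order_trans)
    qed simp
    show "(\<integral>\<^sup>+ x. ?f 0 x \<partial>N) < \<infinity>"
      by (rule order_le_less_trans[OF nn_integral_mono finite_mean]) (auto split: split_indicator)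
  qed simp
  finally obtain i where "(\<integral>\<^sup>+ x. ?f i x \<partial>N) < 1"
    using small by (auto simp: INF_less_iff)
  then obtain \<delta> where \<delta>: "\<delta> > 0" "(\<integral>\<^sup>+ x. e x t * indicator {x. \<sigma> x \<le> \<delta>} x \<partial>N) < 1"
    by (rule that[rotated]) simp
  let ?q = "\<integral>\<^sup>+ x. e x t * indicator {x. \<sigma> x \<le> \<delta>} x \<partial>N"
  \<comment> \<open>For \<open>s \<le> t\<close> the factor at \<open>t\<close> dominates the one at
    \<open>s\<close>, so the same \<delta> and \<open>?q\<close> serve every stride.\<close>
  have step: "total_moment s < \<infinity>" if "total_moment (s - \<delta>) < \<infinity>" "s \<le> t" for s
  proof -
    let ?K = "(\<integral>\<^sup>+ x. e x t \<partial>N) * total_moment (s - \<delta>)"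
    have "?K < \<infinity>"
      using finite_mean that(1) by (simp add: ennreal_mult_less_top)
    then obtain B where B: "1 \<le> B" "B < \<infinity>" "?K + ?q * B \<le> B"
      using ennreal_affine_invariant_bound[OF \<delta>(2)] by blast
    have "moment n s \<le> B" for n
    proof (induction n)
      case (Suc n)
      have "moment (Suc n) s \<le> (\<integral>\<^sup>+ x. e x t * total_moment (s - \<delta>) +
          (e x t * indicator {x. \<sigma> x \<le> \<delta>} x) * B \<partial>N)"
        unfolding moment.simps
      proof (intro nn_integral_mono_AE, use shift_nonneg in eventually_elim)
        case (elim x)
        have le: "e x s \<le> e x t" using factor_mono that(2) .
        show ?case
        proof (cases "\<sigma> x \<le> \<delta>")
          case True
          have "moment n (s - \<sigma> x) \<le> B"
            using moment_mono[of "s - \<sigma> x" s n] elim Suc by simp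
          then have "e x s * moment n (s - \<sigma> x) \<le> e x t * B"
            using le by (intro mult_mono) auto
          then show ?thesis using True by (simp add: add_increasing)
        next
          case False
          have "moment n (s - \<sigma> x) \<le> total_moment (s - \<delta>)"
            using moment_mono[of "s - \<sigma> x" "s - \<delta>" n] moment_le_total[of n "s - \<delta>"] False
            by simp
          then have "e x s * moment n (s - \<sigma> x) \<le> e x t * total_moment (s - \<delta>)"
            using le by (intro mult_mono) auto
          then show ?thesis using False by simp
        qed
      qed
      also have "\<dots> = ?K + ?q * B"
        by (simp add: nn_integral_add nn_integral_multc)
      finally show ?case using B(3) by (rule order_trans)
    qed (use B in simp)
    then have "total_moment s \<le> B"
      unfolding total_moment_def by (intro SUP_least)
    with B show ?thesis by (simp add: order_le_less_trans)
  qed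
  \<comment> \<open>The start lies to the left of \<open>t\<^sub>0\<close>; each lowering of
    \<open>n\<close> in the induction below moves one stride to the right.\<close>
  obtain n :: nat where "t - t\<^sub>0 < real n * \<delta>"
    using \<delta>(1) reals_Archimedean3 by blast
  then have "total_moment (t - real n * \<delta>) < \<infinity>"
    using total_moment_mono[of "t - real n * \<delta>" t\<^sub>0] finite by (simp add: order_le_less_trans)
  then show ?thesis
  proof (induction n)
    case (Suc n)
    have "total_moment (t - real n * \<delta>) < \<infinity>"
      by (rule step) (use Suc.prems \<delta>(1) in \<open>auto simp: algebra_simps\<close>)
    then show ?case by (rule Suc.IH)
  qed simp
qed

section \<open>Integrals over sequences of independent pairs\<close>

sublocale seq: sequence_space N
  by unfold_locales

text \<open>Tonelli after splitting off the first coordinate: prepending an independent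
  \<open>x\<close> to a random sequence reproduces its law.\<close>

lemma nn_integral_sequence_iter:
  assumes [measurable]: "F \<in> borel_measurable seq.S"
  shows "(\<integral>\<^sup>+ p. F p \<partial>seq.S) = (\<integral>\<^sup>+ x. \<integral>\<^sup>+ p. F (case_nat x p) \<partial>seq.S \<partial>N)"
proof -
  have "(\<integral>\<^sup>+ p. F p \<partial>seq.S) =
      (\<integral>\<^sup>+ p. F p \<partial>distr (N \<Otimes>\<^sub>M seq.S) seq.S (\<lambda>(x, p). case_nat x p))"
    by (simp add: seq.PiM_iter)
  also have "\<dots> = (\<integral>\<^sup>+ z. F (case z of (x, p) \<Rightarrow> case_nat x p) \<partial>(N \<Otimes>\<^sub>M seq.S))"
    by (subst nn_integral_distr) auto
  also have "\<dots> = (\<integral>\<^sup>+ x. \<integral>\<^sup>+ p. F (case_nat x p) \<partial>seq.S \<partial>N)"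
    by (subst seq.P.nn_integral_fst[symmetric]) auto
  finally show ?thesis .
qed

lemma nn_integral_sequence_prod:
  "(\<integral>\<^sup>+ p. (\<Prod>k<n. e (p k) (s - (\<Sum>j<k. \<sigma> (p j)))) \<partial>seq.S) = moment n s"
proof (induction n arbitrary: s)
  case 0
  show ?case by (simp add: seq.P.emeasure_space_1)
next
  case (Suc n)
  have "(\<integral>\<^sup>+ p. (\<Prod>k<Suc n. e (p k) (s - (\<Sum>j<k. \<sigma> (p j)))) \<partial>seq.S) =
      (\<integral>\<^sup>+ x. \<integral>\<^sup>+ p. e x s * (\<Prod>k<n. e (p k) (s - \<sigma> x - (\<Sum>j<k. \<sigma> (p j)))) \<partial>seq.S \<partial>N)"
    by (subst nn_integral_sequence_iter)
       (simp_all add: prod.lessThan_Suc_shift sum.lessThan_Suc_shift diff_diff_eq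
          del: prod.lessThan_Suc sum.lessThan_Suc)
  also have "\<dots> = (\<integral>\<^sup>+ x. e x s * moment n (s - \<sigma> x) \<partial>N)"
    by (simp add: nn_integral_cmult Suc)
  finally show ?case by simp
qed

text \<open>The entry \<open>p n\<close> is independent of the earlier shifts and is integrated out
  at a frozen time. A general \<open>H\<close> covers both the excess and the indicator of an
  exceptional set.\<close>

lemma nn_integral_sequence_shifted:
  assumes H: "(\<lambda>(x, s). H x s) \<in> borel_measurable (N \<Otimes>\<^sub>M borel)"
  shows "(\<integral>\<^sup>+ p. H (p n) (s - (\<Sum>j<n. \<sigma> (p j))) \<partial>seq.S) =
    shifted_mean (\<lambda>s. \<integral>\<^sup>+ x. H x s \<partial>N) n s"
proof -
  have H' [measurable]: "(\<lambda>p. H (p n) (s - (\<Sum>j<n. \<sigma> (p j)))) \<in> borel_measurable seq.S" for n s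
    using measurable_compose[OF _ H, of "\<lambda>p. (p n, s - (\<Sum>j<n. \<sigma> (p j)))" seq.S] by simp
  show ?thesis
  proof (induction n arbitrary: s)
    case 0
    have "(\<lambda>x. H x s) \<in> borel_measurable N"
      using measurable_compose[OF _ H, of "\<lambda>x. (x, s)" N] by simp
    then show ?case
      by (subst nn_integral_sequence_iter[OF H']) (simp add: seq.P.emeasure_space_1)
  next
    case (Suc n)
    show ?case
      by (subst nn_integral_sequence_iter[OF H'])
         (simp add: sum.lessThan_Suc_shift diff_diff_eq[symmetric] Suc del: sum.lessThan_Suc)
  qed
qed

text \<open>Independence factorizes the integral; these are the terms of the geometric series behind
  the ladder product.\<close>

lemma nn_integral_sequence_geometric:
  assumes [measurable]: "f \<in> borel_measurable N" "g \<in> borel_measurable N"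
  shows "(\<integral>\<^sup>+ p. (\<Prod>k<n. f (p k)) * g (p n) \<partial>seq.S) =
    (\<integral>\<^sup>+ x. f x \<partial>N) ^ n * (\<integral>\<^sup>+ x. g x \<partial>N)"
proof (induction n)
  case 0
  show ?case
    by (simp, subst nn_integral_sequence_iter) (simp_all add: seq.P.emeasure_space_1)
next
  case (Suc n)
  have "(\<integral>\<^sup>+ p. (\<Prod>k<Suc n. f (p k)) * g (p (Suc n)) \<partial>seq.S) =
      (\<integral>\<^sup>+ x. \<integral>\<^sup>+ p. f x * ((\<Prod>k<n. f (p k)) * g (p n)) \<partial>seq.S \<partial>N)"
    by (subst nn_integral_sequence_iter)
       (simp_all add: prod.lessThan_Suc_shift mult.assoc del: prod.lessThan_Suc)
  also have "\<dots> = (\<integral>\<^sup>+ x. f x \<partial>N) * (\<integral>\<^sup>+ p. (\<Prod>k<n. f (p k)) * g (p n) \<partial>seq.S)"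
    by (simp add: nn_integral_cmult nn_integral_multc)
  finally show ?case by (simp add: Suc mult.assoc)
qed

end

section \<open>The law of the sequence of copies\<close>

lemma measurable_path_component [measurable (raw)]:
  assumes "f \<in> measurable L path_step_space"
  shows "(\<lambda>x. fst (f x) q) \<in> borel_measurable L"
proof -
  have "(\<lambda>x. fst (f x)) \<in> measurable L (\<Pi>\<^sub>M t\<in>(UNIV :: real set). borel)"
    using measurable_compose[OF assms[unfolded path_step_space_def] measurable_fst] .
  from measurable_compose[OF this measurable_component_singleton[of q UNIV]] show ?thesis
    by simp
qed

lemma measurable_path_step [measurable (raw)]:
  assumes "f \<in> measurable L path_step_space"
  shows "(\<lambda>x. snd (f x)) \<in> borel_measurable L"
  using measurable_compose[OF assms[unfolded path_step_space_def] measurable_snd] .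

context renewal_shot_noise
begin

lemma pair_measurable: "(\<lambda>\<omega>. (\<lambda>t. X t \<omega>, \<xi> \<omega>)) \<in> measurable M path_step_space"
proof -
  have "(\<lambda>\<omega>. \<lambda>t\<in>UNIV. X t \<omega>) \<in> measurable M (\<Pi>\<^sub>M t\<in>(UNIV :: real set). borel)"
    by (intro measurable_restrict process_measurable)
  then show ?thesis
    unfolding path_step_space_def using step_measurable by (intro measurable_Pair) (simp_all add: restrict_def)
qed

text \<open>Reindexes the copies from \<open>0\<close>, so that they form a point of the sequence
  space; entry \<open>k\<close> is seen from the position after \<open>k\<close> steps.\<close>

definition copy :: "'a \<Rightarrow> nat \<Rightarrow> (real \<Rightarrow> real) \<times> real" where
  "copy \<omega> k = (\<lambda>t. X' (Suc k) t \<omega>, \<xi>' (Suc k) \<omega>)"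

lemma copy_measurable: "(\<lambda>\<omega>. copy \<omega> k) \<in> measurable M path_step_space"
  using copies_indep by (auto simp: indep_vars_def copy_def)

lemma sum_copy_eq_walk: "(\<Sum>j<n. snd (copy \<omega> j)) = walk \<xi>' n \<omega>"
  by (simp add: copy_def walk_def sum.atLeast1_atMost_eq)

definition step_law :: "((real \<Rightarrow> real) \<times> real) measure" where
  "step_law = distr M path_step_space (\<lambda>\<omega>. (\<lambda>t. X t \<omega>, \<xi> \<omega>))"

lemma sets_step_law [measurable_cong]: "sets step_law = sets path_step_space"
  by (simp add: step_law_def)

lemma prob_space_step_law: "prob_space step_law"
  unfolding step_law_def by (rule prob_space_distr[OF pair_measurable])

lemma nn_integral_step_law:
  "F \<in> borel_measurable path_step_space \<Longrightarrow>
    (\<integral>\<^sup>+ x. F x \<partial>step_law) = (\<integral>\<^sup>+ \<omega>. F (\<lambda>t. X t \<omega>, \<xi> \<omega>) \<partial>M)"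
  by (simp add: step_law_def nn_integral_distr[OF pair_measurable])

text \<open>Independence survives the index shift and all marginals equal \<open>step_law\<close>,
  so the joint law is the product law. Expectations over the copies become integrals over the
  sequence space.\<close>

lemma distr_copy_sequence:
  "distr M (\<Pi>\<^sub>M k\<in>(UNIV :: nat set). path_step_space) copy = (\<Pi>\<^sub>M k\<in>UNIV. step_law)"
proof -
  have law: "distr M path_step_space (\<lambda>\<omega>. copy \<omega> k) = step_law" for k
    using copies_distr[of "Suc k"] by (simp add: copy_def step_law_def)
  have "indep_vars (\<lambda>_. path_step_space) (\<lambda>k \<omega>. copy \<omega> k) UNIV"
    unfolding indep_vars_def2
  proof (intro conjI ballI copy_measurable indep_setsI)
    let ?F = "\<lambda>n. {(\<lambda>\<omega>. (\<lambda>t. X' n t \<omega>, \<xi>' n \<omega>)) -` A \<inter> space M | A. A \<in> sets path_step_space}"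
    have indep: "indep_sets ?F {1..}"
      using copies_indep unfolding indep_vars_def2 by simp
    fix A :: "nat \<Rightarrow> 'a set" and J :: "nat set"
    assume J: "J \<noteq> {}" "J \<subseteq> UNIV" "finite J"
      and A: "\<forall>j\<in>J. A j \<in> {(\<lambda>\<omega>. copy \<omega> j) -` A \<inter> space M | A. A \<in> sets path_step_space}"
    have "prob (\<Inter>j\<in>Suc ` J. A (j - 1)) = (\<Prod>j\<in>Suc ` J. prob (A (j - 1)))"
      by (rule indep_setsD[OF indep]) (use J A in \<open>auto simp: copy_def\<close>)
    then show "prob (\<Inter>j\<in>J. A j) = (\<Prod>j\<in>J. prob (A j))"
      by (simp add: prod.reindex)
  qed (use measurable_sets[OF copy_measurable] in auto)
  then have "distr M (\<Pi>\<^sub>M k\<in>UNIV. path_step_space) (\<lambda>\<omega>. \<lambda>k\<in>UNIV. copy \<omega> k) =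
      (\<Pi>\<^sub>M k\<in>(UNIV :: nat set). distr M path_step_space (\<lambda>\<omega>. copy \<omega> k))"
    by (subst (asm) indep_vars_iff_distr_eq_PiM) (auto intro: copy_measurable)
  then show ?thesis
    by (simp add: law restrict_def)
qed

lemma copy_sequence_measurable:
  "copy \<in> measurable M (\<Pi>\<^sub>M k\<in>(UNIV :: nat set). path_step_space)"
proof -
  have "(\<lambda>\<omega>. \<lambda>k\<in>UNIV. copy \<omega> k) \<in> measurable M (\<Pi>\<^sub>M k\<in>(UNIV :: nat set). path_step_space)"
    by (intro measurable_restrict copy_measurable)
  then show ?thesis by (simp add: restrict_def)
qed

lemma nn_integral_copy_sequence:
  assumes "F \<in> borel_measurable (\<Pi>\<^sub>M k\<in>(UNIV :: nat set). step_law)"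
  shows "(\<integral>\<^sup>+ p. F p \<partial>(\<Pi>\<^sub>M k\<in>UNIV. step_law)) = (\<integral>\<^sup>+ \<omega>. F (copy \<omega>) \<partial>M)"
proof -
  have "F \<in> borel_measurable (\<Pi>\<^sub>M k\<in>(UNIV :: nat set). path_step_space)"
    using assms by (simp add: distr_copy_sequence[symmetric])
  then show ?thesis
    by (simp add: distr_copy_sequence[symmetric] nn_integral_distr[OF copy_sequence_measurable])
qed

text \<open>The renewal measure is the image of counting measure times \<open>M\<close> under
  \<open>?w\<close>; Tonelli then gives the sum.\<close>

lemma nn_integral_renewal_measure:
  assumes [measurable]: "f \<in> borel_measurable borel"
  shows "(\<integral>\<^sup>+ y. f y \<partial>renewal_measure M \<xi>') = (\<Sum>n. \<integral>\<^sup>+ \<omega>. f (walk \<xi>' n \<omega>) \<partial>M)"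
proof -
  let ?P = "count_space (UNIV :: nat set) \<Otimes>\<^sub>M M"
  let ?w = "\<lambda>(n, \<omega>). walk \<xi>' n \<omega>"
  have w [measurable]: "?w \<in> borel_measurable ?P"
    by (rule measurable_pair_measure_countable1) (auto intro: walk_measurable)
  note [measurable] = walk_measurable
  have "renewal_measure M \<xi>' = distr ?P borel ?w"
  proof (rule measure_eqI)
    fix A assume "A \<in> sets (renewal_measure M \<xi>')"
    then have A [measurable]: "A \<in> sets borel" by (simp add: sets_renewal_measure)
    have "emeasure (distr ?P borel ?w) A = (\<integral>\<^sup>+ y. indicator A y \<partial>distr ?P borel ?w)"
      by simp
    also have "\<dots> = (\<integral>\<^sup>+ z. indicator A (?w z) \<partial>?P)"
      by (rule nn_integral_distr[OF w]) simp
    also have "\<dots> = (\<Sum>n. \<integral>\<^sup>+ \<omega>. indicator A (walk \<xi>' n \<omega>) \<partial>M)"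
      by (subst nn_integral_fst[symmetric]) (auto simp: nn_integral_count_space_nat)
    also have "(\<lambda>n. \<integral>\<^sup>+ \<omega>. indicator A (walk \<xi>' n \<omega>) \<partial>M) =
        (\<lambda>n. emeasure M {\<omega> \<in> space M. walk \<xi>' n \<omega> \<in> A})"
    proof
      fix n
      have "(\<integral>\<^sup>+ \<omega>. indicator A (walk \<xi>' n \<omega>) \<partial>M) =
          (\<integral>\<^sup>+ \<omega>. indicator {\<omega> \<in> space M. walk \<xi>' n \<omega> \<in> A} \<omega> \<partial>M)"
        by (rule nn_integral_cong) (auto split: split_indicator)
      then show "(\<integral>\<^sup>+ \<omega>. indicator A (walk \<xi>' n \<omega>) \<partial>M) =
          emeasure M {\<omega> \<in> space M. walk \<xi>' n \<omega> \<in> A}"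
        by simp
    qed
    finally show "emeasure (renewal_measure M \<xi>') A = emeasure (distr ?P borel ?w) A"
      by (simp add: emeasure_renewal_measure[OF A])
  qed (simp add: sets_renewal_measure)
  then have "(\<integral>\<^sup>+ y. f y \<partial>renewal_measure M \<xi>') = (\<integral>\<^sup>+ z. f (?w z) \<partial>?P)"
    by (simp add: nn_integral_distr)
  also have "\<dots> = (\<Sum>n. \<integral>\<^sup>+ \<omega>. f (walk \<xi>' n \<omega>) \<partial>M)"
    by (subst nn_integral_fst[symmetric]) (auto simp: nn_integral_count_space_nat)
  finally show ?thesis .
qed

end

section \<open>A jointly measurable version of the process\<close>

locale nonneg_shot_noise = renewal_shot_noise M X \<xi> X' \<xi>'
  for M :: "'a measure" and X \<xi> X' \<xi>' +
  fixes a :: real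
  assumes rate_pos: "0 < a"
    and step_nonneg: "AE \<omega> in M. 0 \<le> \<xi> \<omega>"
begin

text \<open>The negative exponent keeps the integrand between \<open>0\<close> and \<open>1\<close>,
  so this is finite without any moment hypothesis.\<close>

definition laplace :: "real \<Rightarrow> real" where
  "laplace s = expectation (\<lambda>\<omega>. exp (- a * X s \<omega>))"

text \<open>
  Besides a dense set, the sampling times contain all times at which the process has a jump with
  positive probability; there are only countably many of those because the Laplace transform is
  monotone in time. The two factors below are jointly measurable, enclose \<open>exp (a X(s))\<close> for monotone
  nonnegative paths and agree almost surely at each fixed time, hence also at independent random times.
\<close>

definition sample_times :: "real set" where
  "sample_times = \<rat> \<union> {s. \<not> isCont laplace s}"

definition factor :: "(real \<Rightarrow> real) \<times> real \<Rightarrow> real \<Rightarrow> ennreal" where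
  "factor x s = (SUP q\<in>sample_times. if q \<le> s then max 1 (ennreal (exp (a * fst x q))) else 1)"

definition upper_factor :: "(real \<Rightarrow> real) \<times> real \<Rightarrow> real \<Rightarrow> ennreal" where
  "upper_factor x s = (INF q\<in>sample_times. if s \<le> q then ennreal (exp (a * fst x q)) else \<infinity>)"

lemma integrable_exp_minus: "integrable M (\<lambda>\<omega>. exp (- a * X s \<omega>))"
proof (rule integrable_const_bound[where B = 1])
  show "AE \<omega> in M. norm (exp (- a * X s \<omega>)) \<le> 1"
    using process_nonneg[of _ s] rate_pos by (intro AE_I2) simp
  show "(\<lambda>\<omega>. exp (- a * X s \<omega>)) \<in> borel_measurable M"
    using process_measurable[of s] by measurable
qed

lemma nn_integral_laplace: "(\<integral>\<^sup>+ \<omega>. ennreal (exp (- a * X s \<omega>)) \<partial>M) = ennreal (laplace s)"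
  unfolding laplace_def by (rule nn_integral_eq_integral[OF integrable_exp_minus]) simp

lemma countable_sample_times: "countable sample_times"
proof -
  have "mono (\<lambda>s. - laplace s)"
  proof (rule monoI)
    fix s s' :: real assume "s \<le> s'"
    then have "laplace s' \<le> laplace s"
      unfolding laplace_def using rate_pos monoD[OF process_mono, of _ s s']
      by (intro integral_mono integrable_exp_minus) simp
    then show "- laplace s \<le> - laplace s'" by simp
  qed
  from mono_ctble_discont[OF this] have "countable {s. \<not> isCont (\<lambda>s. - laplace s) s}" .
  moreover have "isCont laplace s" if "isCont (\<lambda>s. - laplace s) s" for s
    using isCont_minus[OF that] by simp
  ultimately have "countable {s. \<not> isCont laplace s}"
    by (elim countable_subset[rotated]) blast
  then show ?thesis
    by (simp add: sample_times_def countable_rat)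
qed

lemma rat_sample: "q \<in> \<rat> \<Longrightarrow> q \<in> sample_times"
  by (simp add: sample_times_def)

text \<open>The truncation by \<open>max 1\<close> and the default \<open>1\<close> secure this for
  every element of the path space, also for paths with negative values.\<close>

lemma factor_ge_1': "1 \<le> factor x s"
  unfolding factor_def by (rule SUP_upper2[OF rat_sample[OF Rats_0]]) auto

lemma factor_mono': "s \<le> s' \<Longrightarrow> factor x s \<le> factor x s'"
  unfolding factor_def by (intro SUP_mono') auto

lemma factor_ge_sample:
  "q \<in> sample_times \<Longrightarrow> q \<le> s \<Longrightarrow> ennreal (exp (a * fst x q)) \<le> factor x s"
  unfolding factor_def by (rule SUP_upper2) auto

lemma upper_factor_le_sample:
  "q \<in> sample_times \<Longrightarrow> s \<le> q \<Longrightarrow> upper_factor x s \<le> ennreal (exp (a * fst x q))"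
  unfolding upper_factor_def by (rule INF_lower2) auto

lemma factor_le_exp:
  assumes "mono f" "\<And>t. 0 \<le> f t"
  shows "factor (f, y) s \<le> ennreal (exp (a * f s))"
  unfolding factor_def
proof (rule SUP_least)
  fix q
  have "1 \<le> ennreal (exp (a * f s))"
    using assms rate_pos by (simp add: one_le_exp_iff flip: ennreal_1 del: ennreal_1)
  moreover have "ennreal (exp (a * f q)) \<le> ennreal (exp (a * f s))" if "q \<le> s"
    using monoD[OF assms(1) that] rate_pos by (intro ennreal_leI) simp
  ultimately show "(if q \<le> s then max 1 (ennreal (exp (a * fst (f, y) q))) else 1) \<le>
      ennreal (exp (a * f s))"
    by simp
qed

lemma exp_le_upper_factor:
  assumes "mono f"
  shows "ennreal (exp (a * f s)) \<le> upper_factor (f, y) s"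
  unfolding upper_factor_def
  using monoD[OF assms, of s] rate_pos by (intro INF_greatest) (auto intro!: ennreal_leI)

lemma factor_measurable_pair:
  "(\<lambda>(x, s). factor x s) \<in> borel_measurable (path_step_space \<Otimes>\<^sub>M borel)"
  unfolding factor_def split_beta'
  by (intro borel_measurable_SUP countable_sample_times) measurable

lemma upper_factor_measurable_pair:
  "(\<lambda>(x, s). upper_factor x s) \<in> borel_measurable (path_step_space \<Otimes>\<^sub>M borel)"
  unfolding upper_factor_def split_beta'
  by (intro borel_measurable_INF countable_sample_times) measurable

lemma factor_measurable_at: "(\<lambda>x. factor x s) \<in> borel_measurable path_step_space"
  using measurable_compose[OF _ factor_measurable_pair, of "\<lambda>x. (x, s)"] by simp

lemma upper_factor_measurable_at: "(\<lambda>x. upper_factor x s) \<in> borel_measurable path_step_space"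
  using measurable_compose[OF _ upper_factor_measurable_pair, of "\<lambda>x. (x, s)"] by simp

text \<open>At a sampling time the path value at \<open>s\<close> itself bounds both extrema.
  Elsewhere \<open>laplace\<close> is continuous, and the reciprocals of the two factors lie between
  exp(-a X) at rational times just before and just after \<open>s\<close>, whose means are
  arbitrarily close.\<close>

lemma AE_factor_eq_upper_factor:
  "AE \<omega> in M. factor (\<lambda>t. X t \<omega>, \<xi> \<omega>) s = upper_factor (\<lambda>t. X t \<omega>, \<xi> \<omega>) s"
proof -
  let ?x = "\<lambda>\<omega>. (\<lambda>t. X t \<omega>, \<xi> \<omega>)"
  have le: "factor (?x \<omega>) s \<le> upper_factor (?x \<omega>) s" if "\<omega> \<in> space M" for \<omega>
    using that process_mono process_nonneg
    by (intro order_trans[OF factor_le_exp exp_le_upper_factor]) auto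
  have "AE \<omega> in M. upper_factor (?x \<omega>) s \<le> factor (?x \<omega>) s"
  proof (cases "s \<in> sample_times")
    case True
    then show ?thesis
      by (intro AE_I2 order_trans[OF upper_factor_le_sample factor_ge_sample]) auto
  next
    case False
    then have cont: "isCont laplace s" by (simp add: sample_times_def)
    \<comment> \<open>Reciprocals are bounded by \<open>1\<close>, so their means can be subtracted
      even if exp(a X(s)) has infinite mean. The order is reversed:
      \<open>h \<le> g\<close>.\<close>
    define g where "g \<omega> = inverse (factor (?x \<omega>) s)" for \<omega>
    define h where "h \<omega> = inverse (upper_factor (?x \<omega>) s)" for \<omega>
    have [measurable]: "g \<in> borel_measurable M" "h \<in> borel_measurable M"
      unfolding g_def h_def
      using measurable_compose[OF pair_measurable factor_measurable_at]
        measurable_compose[OF pair_measurable upper_factor_measurable_at] by auto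
    have anti: "inverse y \<le> inverse x" if "x \<le> y" for x y :: ennreal
      using that by (rule ennreal_inverse_antimono)
    have inv_exp: "inverse (ennreal (exp (a * X q \<omega>))) = ennreal (exp (- a * X q \<omega>))" for q \<omega>
      by (simp add: inverse_ennreal exp_minus)
    have g_le: "(\<integral>\<^sup>+ \<omega>. g \<omega> \<partial>M) \<le> ennreal (laplace q)" if "q \<in> \<rat>" "q \<le> s" for q
    proof -
      have "g \<omega> \<le> ennreal (exp (- a * X q \<omega>))" for \<omega>
        using anti[OF factor_ge_sample[OF rat_sample[OF that(1)] that(2), of "?x \<omega>"]]
        by (simp add: g_def inv_exp)
      then show ?thesis
        unfolding nn_integral_laplace[symmetric] by (rule nn_integral_mono)
    qed
    have h_ge: "ennreal (laplace q) \<le> (\<integral>\<^sup>+ \<omega>. h \<omega> \<partial>M)" if "q \<in> \<rat>" "s \<le> q" for q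
    proof -
      have "ennreal (exp (- a * X q \<omega>)) \<le> h \<omega>" for \<omega>
        using anti[OF upper_factor_le_sample[OF rat_sample[OF that(1)] that(2), of "?x \<omega>"]]
        by (simp add: h_def inv_exp)
      then show ?thesis
        unfolding nn_integral_laplace[symmetric] by (rule nn_integral_mono)
    qed
    have hg: "h \<omega> \<le> g \<omega>" if "\<omega> \<in> space M" for \<omega>
      unfolding g_def h_def by (rule anti[OF le[OF that]])
    have g_le_1: "g \<omega> \<le> 1" for \<omega>
      using anti[OF factor_ge_1', of "?x \<omega>" s] by (simp add: g_def)
    have g_le_h: "(\<integral>\<^sup>+ \<omega>. g \<omega> \<partial>M) \<le> (\<integral>\<^sup>+ \<omega>. h \<omega> \<partial>M)"
    proof (rule ennreal_le_epsilon)
      fix \<epsilon> :: real assume "0 < \<epsilon>"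
      then have "0 < \<epsilon> / 2" by simp
      then obtain \<delta> where \<delta>: "\<delta> > 0" "\<And>q. dist q s < \<delta> \<Longrightarrow> dist (laplace q) (laplace s) < \<epsilon> / 2"
        using cont unfolding continuous_at_eps_delta by blast
      obtain q where q: "q \<in> \<rat>" "s - \<delta> < q" "q < s"
        using Rats_dense_in_real[of "s - \<delta>" s] \<delta>(1) by auto
      obtain q' where q': "q' \<in> \<rat>" "s < q'" "q' < s + \<delta>"
        using Rats_dense_in_real[of s "s + \<delta>"] \<delta>(1) by auto
      have "laplace q \<le> laplace q' + \<epsilon>"
        using \<delta>(2)[of q] \<delta>(2)[of q'] q q' unfolding dist_real_def by linarith
      moreover have "0 \<le> laplace q'"
        unfolding laplace_def by (rule integral_nonneg_AE) simp
      ultimately have "ennreal (laplace q) \<le> ennreal (laplace q') + ennreal \<epsilon>"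
        using \<open>0 < \<epsilon>\<close> by (simp add: ennreal_leI flip: ennreal_plus)
      also have "\<dots> \<le> (\<integral>\<^sup>+ \<omega>. h \<omega> \<partial>M) + ennreal \<epsilon>"
        using h_ge[of q'] q' by (intro add_right_mono) simp
      finally show "(\<integral>\<^sup>+ \<omega>. g \<omega> \<partial>M) \<le> (\<integral>\<^sup>+ \<omega>. h \<omega> \<partial>M) + ennreal \<epsilon>"
        using g_le[of q] q by (auto intro: order_trans)
    qed
    have g_fin: "(\<integral>\<^sup>+ \<omega>. g \<omega> \<partial>M) \<le> 1"
      using nn_integral_mono[of M g "\<lambda>_. 1"] g_le_1 by (simp add: emeasure_space_1)
    have h_fin: "(\<integral>\<^sup>+ \<omega>. h \<omega> \<partial>M) < \<infinity>"
      using order_trans[OF nn_integral_mono[of M h g] g_fin] hg by (simp add: order_le_less_trans)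
    have "(\<integral>\<^sup>+ \<omega>. g \<omega> - h \<omega> \<partial>M) = 0"
      using h_fin hg g_le_h g_fin
      by (subst nn_integral_diff) (auto simp: diff_eq_0_iff_ennreal intro: order_le_less_trans)
    then have "AE \<omega> in M. g \<omega> - h \<omega> = 0"
      by (subst (asm) nn_integral_0_iff_AE) auto
    then show ?thesis
    proof (eventually_elim)
      case (elim \<omega>)
      then have "inverse (factor (?x \<omega>) s) \<le> inverse (upper_factor (?x \<omega>) s)"
        unfolding g_def h_def by (rule ennreal_minus_eq_0)
      from anti[OF this] show ?case
        by simp
    qed
  qed
  then show ?thesis
    by (rule AE_mp) (intro AE_I2 impI antisym le)
qed

lemma AE_factor_eq_exp:
  "AE \<omega> in M. factor (\<lambda>t. X t \<omega>, \<xi> \<omega>) s = ennreal (exp (a * X s \<omega>))"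
proof (rule AE_mp[OF AE_factor_eq_upper_factor[of s]], intro AE_I2 impI antisym)
  fix \<omega> assume "\<omega> \<in> space M"
    and eq: "factor (\<lambda>t. X t \<omega>, \<xi> \<omega>) s = upper_factor (\<lambda>t. X t \<omega>, \<xi> \<omega>) s"
  then show "factor (\<lambda>t. X t \<omega>, \<xi> \<omega>) s \<le> ennreal (exp (a * X s \<omega>))"
    using process_mono process_nonneg by (intro factor_le_exp)
  show "ennreal (exp (a * X s \<omega>)) \<le> factor (\<lambda>t. X t \<omega>, \<xi> \<omega>) s"
    unfolding eq using \<open>\<omega> \<in> space M\<close> process_mono by (intro exp_le_upper_factor)
qed

section \<open>Transfer to the shot noise\<close>

sublocale mult: multiplicative_shot step_law factor snd
proof -
  interpret L: prob_space step_law by (rule prob_space_step_law)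
  show "multiplicative_shot step_law factor snd"
  proof (unfold_locales)
    show "(\<lambda>(x, s). factor x s) \<in> borel_measurable (step_law \<Otimes>\<^sub>M borel)"
      using factor_measurable_pair by (simp cong: measurable_cong_sets sets_pair_measure_cong add: sets_step_law)
    show "snd \<in> borel_measurable step_law"
      by measurable
    show "AE x in step_law. 0 \<le> snd x"
      unfolding step_law_def using step_nonneg
      by (subst AE_distr_iff[OF pair_measurable]) simp_all
  qed (auto simp: factor_ge_1' factor_mono')
qed

lemma excess_eq: "mult.excess s = (\<integral>\<^sup>+ \<omega>. ennreal (exp (a * X s \<omega>) - 1) \<partial>M)"
proof -
  have "mult.excess s = (\<integral>\<^sup>+ \<omega>. factor (\<lambda>t. X t \<omega>, \<xi> \<omega>) s - 1 \<partial>M)"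
    unfolding mult.nn_integral_factor_minus_1[symmetric]
    by (rule nn_integral_step_law) (use factor_measurable_at in measurable)
  also have "\<dots> = (\<integral>\<^sup>+ \<omega>. ennreal (exp (a * X s \<omega>) - 1) \<partial>M)"
    using AE_factor_eq_exp[of s]
    by (intro nn_integral_cong_AE) (auto elim!: eventually_mono simp: ennreal_minus simp flip: ennreal_1)
  finally show ?thesis .
qed

lemma mean_exp_eq: "(\<integral>\<^sup>+ \<omega>. ennreal (exp (a * X s \<omega>)) \<partial>M) = 1 + mult.excess s"
proof -
  have "(\<integral>\<^sup>+ \<omega>. ennreal (exp (a * X s \<omega>)) \<partial>M) = (\<integral>\<^sup>+ \<omega>. factor (\<lambda>t. X t \<omega>, \<xi> \<omega>) s \<partial>M)"
    using AE_factor_eq_exp[of s] by (intro nn_integral_cong_AE) (auto elim!: eventually_mono)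
  also have "\<dots> = (\<integral>\<^sup>+ x. factor x s \<partial>step_law)"
    by (rule nn_integral_step_law[OF factor_measurable_at, symmetric])
  finally show ?thesis by (simp add: mult.mean_factor_eq)
qed

lemma r_fun_integral: "r_fun M X \<xi>' a t = (\<integral>\<^sup>+ y. mult.excess (t - y) \<partial>renewal_measure M \<xi>')"
  by (simp add: r_fun_def mean_exp_eq)

text \<open>The renewal integral is a sum over the walk positions, and each term is carried to the
  sequence space by the law of the copies.\<close>

lemma r_fun_eq: "r_fun M X \<xi>' a t = (\<Sum>n. mult.shifted_mean mult.excess n t)"
proof -
  have "(\<integral>\<^sup>+ \<omega>. mult.excess (t - walk \<xi>' n \<omega>) \<partial>M) = mult.shifted_mean mult.excess n t" for n
  proof -
    have "mult.shifted_mean mult.excess n t =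
        (\<integral>\<^sup>+ p. mult.excess (t - (\<Sum>j<n. snd (p j))) \<partial>mult.seq.S)"
      by (subst mult.nn_integral_sequence_shifted) simp_all
    also have "\<dots> = (\<integral>\<^sup>+ \<omega>. mult.excess (t - (\<Sum>j<n. snd (copy \<omega> j))) \<partial>M)"
      by (rule nn_integral_copy_sequence) simp
    finally show ?thesis by (simp add: sum_copy_eq_walk)
  qed
  then show ?thesis
    unfolding r_fun_integral by (subst nn_integral_renewal_measure) simp_all
qed

text \<open>Each copy is independent of the preceding steps, so the almost sure equality at fixed
  times extends to the random time \<open>t - walk \<xi>' n \<omega>\<close>.\<close>

lemma AE_copies_factor_eq_exp:
  "AE \<omega> in M. \<forall>n. factor (copy \<omega> n) (t - walk \<xi>' n \<omega>) =
    ennreal (exp (a * X' (Suc n) (t - walk \<xi>' n \<omega>) \<omega>))"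
  unfolding AE_all_countable
proof
  fix n
  \<comment> \<open>Indicator of disagreement of the two factors. It is jointly measurable, whereas
    evaluation of a path at a random time need not be.\<close>
  define H :: "(real \<Rightarrow> real) \<times> real \<Rightarrow> real \<Rightarrow> ennreal"
    where "H x s = (if factor x s = upper_factor x s then 0 else 1)" for x s
  have [measurable (raw)]: "(\<lambda>x. upper_factor (f x) (g x)) \<in> borel_measurable L"
    if "f \<in> measurable L step_law" "g \<in> borel_measurable L" for L :: "'c measure" and f g
    using measurable_compose[OF _ upper_factor_measurable_pair, of "\<lambda>x. (f x, g x)" L] that
    by (simp cong: measurable_cong_sets add: sets_step_law)
  have H: "(\<lambda>(x, s). H x s) \<in> borel_measurable (step_law \<Otimes>\<^sub>M borel)"
    unfolding H_def split_beta' by measurable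
  have H_at: "(\<lambda>x. H x s) \<in> borel_measurable path_step_space" for s
    using measurable_compose[OF _ H, of "\<lambda>x. (x, s)" step_law]
    by (simp cong: measurable_cong_sets add: sets_step_law)
  have H': "(\<lambda>p. H (p n) (t - (\<Sum>j<n. snd (p j)))) \<in> borel_measurable mult.seq.S"
    unfolding H_def by measurable
  have zero: "(\<integral>\<^sup>+ x. H x s \<partial>step_law) = 0" for s
  proof -
    have "(\<integral>\<^sup>+ x. H x s \<partial>step_law) = (\<integral>\<^sup>+ \<omega>. 0 \<partial>M)"
      unfolding nn_integral_step_law[OF H_at] using AE_factor_eq_upper_factor[of s]
      by (intro nn_integral_cong_AE) (auto elim!: eventually_mono simp: H_def)
    then show ?thesis by simp
  qed
  have shifted_zero: "mult.shifted_mean (\<lambda>_. 0) n s = 0" for s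
    by (induction n arbitrary: s) simp_all
  have "(\<integral>\<^sup>+ \<omega>. H (copy \<omega> n) (t - walk \<xi>' n \<omega>) \<partial>M) = 0"
    using nn_integral_copy_sequence[OF H'] mult.nn_integral_sequence_shifted[OF H, of n t]
    by (simp add: zero shifted_zero sum_copy_eq_walk)
  moreover have "(\<lambda>\<omega>. H (copy \<omega> n) (t - walk \<xi>' n \<omega>)) \<in> borel_measurable M"
    using measurable_compose[OF copy_sequence_measurable, of "\<lambda>p. H (p n) (t - (\<Sum>j<n. snd (p j)))" borel] H'
    by (simp add: sum_copy_eq_walk distr_copy_sequence[symmetric])
  ultimately have "AE \<omega> in M. H (copy \<omega> n) (t - walk \<xi>' n \<omega>) = 0"
    by (simp add: nn_integral_0_iff_AE)
  then show "AE \<omega> in M. factor (copy \<omega> n) (t - walk \<xi>' n \<omega>) =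
    ennreal (exp (a * X' (Suc n) (t - walk \<xi>' n \<omega>) \<omega>))"
  proof (rule AE_mp, intro AE_I2 impI antisym)
    fix \<omega> assume \<omega>: "\<omega> \<in> space M" and "H (copy \<omega> n) (t - walk \<xi>' n \<omega>) = 0"
    then have eq: "factor (copy \<omega> n) (t - walk \<xi>' n \<omega>) = upper_factor (copy \<omega> n) (t - walk \<xi>' n \<omega>)"
      by (simp add: H_def split: if_splits)
    show "factor (copy \<omega> n) (t - walk \<xi>' n \<omega>) \<le>
        ennreal (exp (a * X' (Suc n) (t - walk \<xi>' n \<omega>) \<omega>))"
      unfolding copy_def using \<omega> copies_mono copies_nonneg by (intro factor_le_exp) auto
    show "ennreal (exp (a * X' (Suc n) (t - walk \<xi>' n \<omega>) \<omega>)) \<le>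
        factor (copy \<omega> n) (t - walk \<xi>' n \<omega>)"
      unfolding eq unfolding copy_def using \<omega> copies_mono by (intro exp_le_upper_factor) auto
  qed
qed

lemma exp_shot_noise:
  assumes "\<omega> \<in> space M"
  shows "exp_ennreal (ennreal a * shot_noise X' \<xi>' t \<omega>) =
    (SUP n. \<Prod>k<n. ennreal (exp (a * X' (Suc k) (t - walk \<xi>' k \<omega>) \<omega>)))"
proof -
  have "ennreal a * shot_noise X' \<xi>' t \<omega> =
      (\<Sum>k. ennreal (a * X' (Suc k) (t - walk \<xi>' k \<omega>) \<omega>))"
    unfolding shot_noise_def using rate_pos copies_nonneg[OF _ assms]
    by (simp add: ennreal_mult flip: ennreal_suminf_cmult)
  then show ?thesis
    using rate_pos copies_nonneg[OF _ assms] by (simp add: exp_ennreal_suminf)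
qed

text \<open>The integrand is first replaced almost surely by a measurable one built from
  \<open>factor\<close>; the product law of the copies and monotone convergence then apply.\<close>

lemma nn_integral_exp_shot_noise:
  "(\<integral>\<^sup>+ \<omega>. exp_ennreal (ennreal a * shot_noise X' \<xi>' t \<omega>) \<partial>M) = mult.total_moment t"
proof -
  define G where "G n p = (\<Prod>k<n. factor (p k) (t - (\<Sum>j<k. snd (p j))))"
    for n :: nat and p :: "nat \<Rightarrow> (real \<Rightarrow> real) \<times> real"
  have G: "G n \<in> borel_measurable mult.seq.S" for n
    unfolding G_def by measurable
  have G_inc: "incseq (\<lambda>n. G n p)" for p
  proof (rule incseq_SucI)
    show "G n p \<le> G (Suc n) p" for n
      using mult_left_mono[OF factor_ge_1', of "G n p"] by (simp add: G_def)
  qed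
  have "(\<integral>\<^sup>+ \<omega>. exp_ennreal (ennreal a * shot_noise X' \<xi>' t \<omega>) \<partial>M) =
      (\<integral>\<^sup>+ \<omega>. (SUP n. G n (copy \<omega>)) \<partial>M)"
    using AE_copies_factor_eq_exp[of t] AE_space
    by (intro nn_integral_cong_AE, eventually_elim)
       (simp add: exp_shot_noise G_def sum_copy_eq_walk)
  also have "\<dots> = (\<integral>\<^sup>+ p. (SUP n. G n p) \<partial>mult.seq.S)"
    by (rule nn_integral_copy_sequence[symmetric]) (intro borel_measurable_SUP G, simp)
  also have "\<dots> = (SUP n. \<integral>\<^sup>+ p. G n p \<partial>mult.seq.S)"
    by (rule nn_integral_monotone_convergence_SUP)
       (use G_inc G in \<open>auto simp: incseq_def le_fun_def\<close>)
  also have "\<dots> = mult.total_moment t"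
    by (simp add: G_def mult.nn_integral_sequence_prod mult.total_moment_def)
  finally show ?thesis .
qed

section \<open>The ladder product and the renewal integral\<close>

text \<open>The ladder product is one of the finite products whose supremum is the exponential of
  the noise.\<close>

lemma l_fun_le_total_moment: "l_fun M X' \<xi>' a t \<le> mult.total_moment t"
  unfolding l_fun_def nn_integral_exp_shot_noise[symmetric]
proof (rule nn_integral_mono)
  fix \<omega> assume \<omega>: "\<omega> \<in> space M"
  let ?f = "\<lambda>n. ennreal (exp (a * X' n (t - walk \<xi>' (n - 1) \<omega>) \<omega>))"
  let ?A = "{n. 1 \<le> n \<and> enat n \<le> first_ascent \<xi>' \<omega>}"
  obtain m where "(\<Prod>n\<in>?A. ?f n) = (\<Prod>n\<in>{1..m}. ?f n)"
  proof (cases "first_ascent \<xi>' \<omega>")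
    case (enat m)
    then have "?A = {1..m}" by auto
    then show ?thesis using that by metis
  next
    case infinity
    then have "infinite ?A"
      using infinite_Ici[of "1 :: nat"] by (simp add: atLeast_def)
    \<comment> \<open>A product over an infinite set is \<open>1\<close>, which is the empty product
      \<open>m = 0\<close>.\<close>
    then show ?thesis using that[of 0] by simp
  qed
  also have "(\<Prod>n\<in>{1..m}. ?f n) = (\<Prod>k<m. ennreal (exp (a * X' (Suc k) (t - walk \<xi>' k \<omega>) \<omega>)))"
    by (simp add: prod.atLeast1_atMost_eq)
  also have "\<dots> \<le> exp_ennreal (ennreal a * shot_noise X' \<xi>' t \<omega>)"
    unfolding exp_shot_noise[OF \<omega>] by (rule SUP_upper) simp
  finally show "(\<Prod>n\<in>?A. ?f n) \<le> exp_ennreal (ennreal a * shot_noise X' \<xi>' t \<omega>)" .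
qed

text \<open>Dominated convergence is used twice: under \<open>M\<close> for paths vanishing at minus
  infinity, then under the renewal measure with the integrand of \<open>r_fun\<close> at
  \<open>t\<close> as dominating function.\<close>

lemma r_fun_small:
  assumes fin: "r_fun M X \<xi>' a t < \<infinity>"
  obtains t\<^sub>0 where "t\<^sub>0 \<le> t" "r_fun M X \<xi>' a t\<^sub>0 < 1"
proof -
  have excess_mono: "mult.excess s \<le> mult.excess s'" if "s \<le> s'" for s s'
    unfolding mult.excess_def
    by (intro ennreal_minus_mono nn_integral_mono factor_mono' that) simp
  have excess_lim: "(\<lambda>n. mult.excess (s - real n)) \<longlonglongrightarrow> 0" if "mult.excess s < \<infinity>" for s
  proof -
    have [measurable]: "X s \<in> borel_measurable M" for s by (rule process_measurable)
    have "(\<lambda>n. \<integral>\<^sup>+ \<omega>. ennreal (exp (a * X (s - real n) \<omega>) - 1) \<partial>M) \<longlonglongrightarrow> (\<integral>\<^sup>+ \<omega>. 0 \<partial>M)"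
    proof (rule nn_integral_dominated_convergence[where w = "\<lambda>\<omega>. ennreal (exp (a * X s \<omega>) - 1)"])
      show "AE \<omega> in M. ennreal (exp (a * X (s - real n) \<omega>) - 1) \<le> ennreal (exp (a * X s \<omega>) - 1)" for n
        using rate_pos monoD[OF process_mono, of _ "s - real n" s]
        by (intro AE_I2 ennreal_leI) simp
      show "AE \<omega> in M. (\<lambda>n. ennreal (exp (a * X (s - real n) \<omega>) - 1)) \<longlonglongrightarrow> 0"
        using process_limit
      proof eventually_elim
        case (elim \<omega>)
        have "filterlim (\<lambda>n. s - real n) at_bot sequentially"
          by real_asymp
        then have "(\<lambda>n. X (s - real n) \<omega>) \<longlonglongrightarrow> 0"
          by (rule filterlim_compose[OF elim])
        then have "(\<lambda>n. ennreal (exp (a * X (s - real n) \<omega>) - 1)) \<longlonglongrightarrow> ennreal (exp (a * 0) - 1)"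
          by (intro tendsto_intros)
        then show ?case by simp
      qed
    qed (use that in \<open>simp_all add: excess_eq\<close>)
    then show ?thesis by (simp add: excess_eq)
  qed
  let ?U = "renewal_measure M \<xi>'"
  have U [measurable_cong]: "sets ?U = sets borel" by (rule sets_renewal_measure)
  have "(\<lambda>n. \<integral>\<^sup>+ y. mult.excess (t - real n - y) \<partial>?U) \<longlonglongrightarrow> (\<integral>\<^sup>+ y. 0 \<partial>?U)"
  proof (rule nn_integral_dominated_convergence[where w = "\<lambda>y. mult.excess (t - y)"])
    show "AE y in ?U. mult.excess (t - real n - y) \<le> mult.excess (t - y)" for n
      by (intro AE_I2 excess_mono) simp
    \<comment> \<open>The inner convergence needs a finite excess, which the finite integral
      guarantees almost everywhere.\<close>
    have "AE y in ?U. mult.excess (t - y) \<noteq> \<infinity>"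
      using fin unfolding r_fun_integral by (intro nn_integral_PInf_AE) simp_all
    then show "AE y in ?U. (\<lambda>n. mult.excess (t - real n - y)) \<longlonglongrightarrow> 0"
    proof eventually_elim
      case (elim y)
      then show ?case
        using excess_lim[of "t - y"] by (simp add: less_top algebra_simps)
    qed
  qed (use fin in \<open>simp_all add: r_fun_integral\<close>)
  then have "(\<lambda>n. r_fun M X \<xi>' a (t - real n)) \<longlonglongrightarrow> 0"
    by (simp add: r_fun_integral)
  then have "\<forall>\<^sub>F n in sequentially. r_fun M X \<xi>' a (t - real n) < 1"
    by (rule order_tendstoD) simp
  then obtain n where "r_fun M X \<xi>' a (t - real n) < 1"
    by (auto simp: eventually_sequentially)
  then show thesis
    by (intro that[of "t - real n"]) simp
qed

lemma first_ascent_eq_Suc: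
  assumes "\<And>k. k < j \<Longrightarrow> \<xi>' (Suc k) \<omega> = 0" "0 < \<xi>' (Suc j) \<omega>"
  shows "first_ascent \<xi>' \<omega> = enat (Suc j)"
    and "k \<le> j \<Longrightarrow> walk \<xi>' k \<omega> = 0"
proof -
  have walk_0: "walk \<xi>' k \<omega> = 0" if "k \<le> j" for k
    using that assms(1) by (simp add: sum_copy_eq_walk[symmetric] copy_def)
  have "walk \<xi>' (Suc j) \<omega> = walk \<xi>' j \<omega> + \<xi>' (Suc j) \<omega>"
    by (simp add: walk_def)
  then have "0 < walk \<xi>' (Suc j) \<omega>"
    using assms(2) walk_0[of j] by simp
  then show "first_ascent \<xi>' \<omega> = enat (Suc j)"
    unfolding first_ascent_def
  proof (intro antisym Inf_greatest Inf_lower imageI)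
    fix z assume "z \<in> enat ` {n. 1 \<le> n \<and> 0 < walk \<xi>' n \<omega>}"
    then obtain n where "z = enat n" "0 < walk \<xi>' n \<omega>" by auto
    with walk_0[of n] show "enat (Suc j) \<le> z"
      by (cases "n \<le> j") auto
  qed simp
  show "k \<le> j \<Longrightarrow> walk \<xi>' k \<omega> = 0" by (rule walk_0)
qed

text \<open>
  Up to the first ascent the walk stays at the origin, so that the ladder product decomposes into a
  geometric series whose ratio is the integral below.
\<close>

lemma l_fun_finite_imp_ratio_less_1:
  assumes fin: "l_fun M X' \<xi>' a t < \<infinity>"
  shows "(\<integral>\<^sup>+ x. factor x t * indicator {x. snd x = 0} x \<partial>step_law) < 1"
proof (rule ccontr)
  define f where "f x = factor x t * indicator {x. snd x = 0} x" for x
  define g where "g x = factor x t * indicator {x. 0 < snd x} x" for x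
  \<comment> \<open>The contribution of a first ascent at \<open>j + 1\<close>: \<open>j\<close>
    vanishing steps followed by a positive one.\<close>
  define F where "F j p = (\<Prod>k<j. f (p k)) * g (p j)"
    for j :: nat and p :: "nat \<Rightarrow> (real \<Rightarrow> real) \<times> real"
  have [measurable]: "f \<in> borel_measurable step_law" "g \<in> borel_measurable step_law"
    unfolding f_def g_def by measurable
  have F: "F j \<in> borel_measurable mult.seq.S" for j
    unfolding F_def by measurable
  assume "\<not> (\<integral>\<^sup>+ x. factor x t * indicator {x. snd x = 0} x \<partial>step_law) < 1"
  then have ratio: "1 \<le> (\<integral>\<^sup>+ x. f x \<partial>step_law)"
    by (simp add: f_def not_less)
  let ?\<beta> = "\<integral>\<^sup>+ x. g x \<partial>step_law"
  let ?prod = "\<lambda>\<omega>. \<Prod>n\<in>{n. 1 \<le> n \<and> enat n \<le> first_ascent \<xi>' \<omega>}.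
      ennreal (exp (a * X' n (t - walk \<xi>' (n - 1) \<omega>) \<omega>))"
  \<comment> \<open>The step patterns for different \<open>j\<close> exclude each other, so at most
    one summand survives. Its walk is \<open>0\<close> up to index \<open>j\<close>, hence all
    factors are taken at \<open>t\<close>.\<close>
  have le: "(\<Sum>j<N. F j (copy \<omega>)) \<le> ?prod \<omega>" if \<omega>: "\<omega> \<in> space M" for N \<omega>
  proof (cases "\<exists>j<N. F j (copy \<omega>) \<noteq> 0")
    case True
    then obtain j where j: "j < N" "F j (copy \<omega>) \<noteq> 0" by blast
    then have f_nz: "f (copy \<omega> k) \<noteq> 0" if "k < j" for k
      using that by (auto simp: F_def prod_zero_iff)
    have zero: "\<xi>' (Suc k) \<omega> = 0" if "k < j" for k
      using f_nz[OF that] by (auto simp: f_def copy_def split: split_indicator_asm)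
    have "g (copy \<omega> j) \<noteq> 0" using j(2) by (auto simp: F_def)
    then have pos: "0 < \<xi>' (Suc j) \<omega>"
      by (auto simp: g_def copy_def split: split_indicator_asm)
    have "F i (copy \<omega>) = 0" if "i \<noteq> j" for i
    proof (cases "i < j")
      case True
      then have "g (copy \<omega> i) = 0" using zero by (simp add: g_def copy_def)
      then show ?thesis by (simp add: F_def)
    next
      case False
      with that have "j < i" by simp
      moreover have "f (copy \<omega> j) = 0" using pos by (simp add: f_def copy_def)
      ultimately show ?thesis by (auto simp: F_def prod_zero_iff)
    qed
    then have "(\<Sum>i<N. F i (copy \<omega>)) = (\<Sum>i<N. if i = j then F j (copy \<omega>) else 0)"
      by (intro sum.cong) auto
    also have "\<dots> = F j (copy \<omega>)"
      using j(1) by simp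
    also have "\<dots> \<le> (\<Prod>k<Suc j. factor (copy \<omega> k) t)"
      unfolding F_def prod.lessThan_Suc
      by (intro mult_mono prod_mono_ennreal) (auto simp: f_def g_def split: split_indicator)
    also have "\<dots> \<le> (\<Prod>k<Suc j. ennreal (exp (a * X' (Suc k) (t - walk \<xi>' k \<omega>) \<omega>)))"
    proof (rule prod_mono_ennreal)
      fix k assume "k \<in> {..<Suc j}"
      then have "walk \<xi>' k \<omega> = 0"
        using first_ascent_eq_Suc(2)[OF zero pos] by simp
      then show "factor (copy \<omega> k) t \<le> ennreal (exp (a * X' (Suc k) (t - walk \<xi>' k \<omega>) \<omega>))"
        unfolding copy_def
        using \<omega> copies_mono[of "Suc k"] copies_nonneg[of "Suc k"]
          factor_le_exp[of "\<lambda>s. X' (Suc k) s \<omega>" "\<xi>' (Suc k) \<omega>" t]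
        by simp
    qed
    also have "\<dots> = ?prod \<omega>"
    proof -
      have "first_ascent \<xi>' \<omega> = enat (Suc j)"
        by (rule first_ascent_eq_Suc(1)[OF zero pos])
      then have "{n. 1 \<le> n \<and> enat n \<le> first_ascent \<xi>' \<omega>} = {1..Suc j}"
        by auto
      then show ?thesis by (simp only: One_nat_def prod.atLeast1_atMost_eq diff_Suc_Suc diff_zero)
    qed
    finally show ?thesis .
  qed simp
  \<comment> \<open>With ratio at least \<open>1\<close> each term of the geometric series is at
    least \<open>?\<beta>\<close>; as \<open>N\<close> is arbitrary, finiteness forces
    \<open>?\<beta> = 0\<close>.\<close>
  have bound: "of_nat N * ?\<beta> \<le> l_fun M X' \<xi>' a t" for N
  proof -
    have "of_nat N * ?\<beta> = (\<Sum>j<N. 1 * ?\<beta>)" by simp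
    also have "\<dots> \<le> (\<Sum>j<N. (\<integral>\<^sup>+ x. f x \<partial>step_law) ^ j * ?\<beta>)"
      by (intro sum_mono mult_right_mono one_le_power ratio) simp
    also have "\<dots> = (\<integral>\<^sup>+ p. (\<Sum>j<N. F j p) \<partial>mult.seq.S)"
      using F by (simp add: nn_integral_sum) (simp add: F_def mult.nn_integral_sequence_geometric)
    also have "\<dots> = (\<integral>\<^sup>+ \<omega>. (\<Sum>j<N. F j (copy \<omega>)) \<partial>M)"
      by (rule nn_integral_copy_sequence) (intro borel_measurable_sum F)
    also have "\<dots> \<le> l_fun M X' \<xi>' a t"
      unfolding l_fun_def by (intro nn_integral_mono le)
    finally show ?thesis .
  qed
  have "?\<beta> = 0"
  proof (rule ccontr)
    assume "?\<beta> \<noteq> 0"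
    moreover have "?\<beta> < \<infinity>" using bound[of 1] fin by (simp add: order_le_less_trans)
    ultimately obtain b where b: "?\<beta> = ennreal b" "0 < b"
      by (cases ?\<beta>) (auto simp: le_less)
    obtain L where L: "l_fun M X' \<xi>' a t = ennreal L" "0 \<le> L"
      using fin by (cases "l_fun M X' \<xi>' a t") auto
    obtain N :: nat where "L < real N * b"
      using reals_Archimedean3[OF b(2)] by blast
    moreover have "real N * b \<le> L"
      using bound[of N] b L by (simp add: ennreal_of_nat_eq_real_of_nat flip: ennreal_mult)
    ultimately show False by simp
  qed
  \<comment> \<open>Since \<open>factor\<close> is at least \<open>1\<close>, a vanishing
    \<open>g\<close> excludes positive steps. The step would then be almost surely \<open>0\<close>,
    contrary to nontriviality.\<close>
  then have "AE x in step_law. g x = 0"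
    by (simp add: nn_integral_0_iff_AE)
  then have "AE \<omega> in M. g (\<lambda>t. X t \<omega>, \<xi> \<omega>) = 0"
    unfolding step_law_def by (rule AE_distrD[OF pair_measurable])
  then have "AE \<omega> in M. \<xi> \<omega> = 0"
    using step_nonneg
  proof eventually_elim
    case (elim \<omega>)
    moreover have "factor (\<lambda>t. X t \<omega>, \<xi> \<omega>) t \<noteq> 0"
      using factor_ge_1'[of "(\<lambda>t. X t \<omega>, \<xi> \<omega>)" t] by auto
    ultimately show ?case
      by (auto simp: g_def split: split_indicator_asm)
  qed
  then have "prob {\<omega> \<in> space M. \<xi> \<omega> = 0} = 1"
    using step_measurable by (subst prob_Collect_eq_1) auto
  with step_nontrivial show False by simp
qed

text \<open>Far enough to the left the renewal integral drops below \<open>1\<close>. This also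
  supplies the starting point for the extension to \<open>t\<close>.\<close>

lemma exp_moment_finite_below:
  assumes "r_fun M X \<xi>' a t < \<infinity>"
  obtains t\<^sub>0 where "t\<^sub>0 \<le> t" "mult.total_moment t\<^sub>0 < \<infinity>"
proof -
  obtain t\<^sub>0 where "t\<^sub>0 \<le> t" "r_fun M X \<xi>' a t\<^sub>0 < 1"
    using assms by (rule r_fun_small)
  then show thesis
    by (intro that[of t\<^sub>0] mult.total_moment_finite_if_small) (simp_all add: r_fun_eq)
qed

lemma exp_moment_finite_iff:
  "mult.total_moment t < \<infinity> \<longleftrightarrow> r_fun M X \<xi>' a t < \<infinity> \<and> l_fun M X' \<xi>' a t < \<infinity>"
proof (intro iffI conjI)
  assume "mult.total_moment t < \<infinity>"
  then have "1 + r_fun M X \<xi>' a t < \<infinity>"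
    using mult.suminf_excess_le_total[of t] unfolding r_fun_eq by (rule order_le_less_trans[rotated])
  then show "r_fun M X \<xi>' a t < \<infinity>" by simp
  show "l_fun M X' \<xi>' a t < \<infinity>"
    using l_fun_le_total_moment \<open>mult.total_moment t < \<infinity>\<close> by (rule order_le_less_trans)
next
  assume fin: "r_fun M X \<xi>' a t < \<infinity> \<and> l_fun M X' \<xi>' a t < \<infinity>"
  then obtain t\<^sub>0 where below: "mult.total_moment t\<^sub>0 < \<infinity>"
    using exp_moment_finite_below by blast
  \<comment> \<open>The walk starts at \<open>0\<close>, so the term for \<open>n = 0\<close> is the
    excess at \<open>t\<close> itself; this yields the finite mean needed for the extension.\<close>
  have "mult.shifted_mean mult.excess 0 t \<le> r_fun M X \<xi>' a t"
    unfolding r_fun_eq using sum_le_suminf[of "\<lambda>n. mult.shifted_mean mult.excess n t" "{0}"] by simp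
  then have "mult.excess t < \<infinity>"
    using fin by (simp add: order_le_less_trans)
  then have mean: "(\<integral>\<^sup>+ x. factor x t \<partial>step_law) < \<infinity>"
    by (simp add: mult.mean_factor_eq)
  have ratio: "(\<integral>\<^sup>+ x. factor x t * indicator {x. snd x = 0} x \<partial>step_law) < 1"
    using fin by (intro l_fun_finite_imp_ratio_less_1) simp
  show "mult.total_moment t < \<infinity>"
    by (rule mult.total_moment_finite_extend[OF mean ratio below])
qed

end

theorem theorem3p4:
  fixes M :: "'a measure"
    and X :: "real \<Rightarrow> 'a \<Rightarrow> real" and \<xi> :: "'a \<Rightarrow> real"
    and X' :: "nat \<Rightarrow> real \<Rightarrow> 'a \<Rightarrow> real" and \<xi>' :: "nat \<Rightarrow> 'a \<Rightarrow> real"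
    and a t :: real
  assumes "renewal_shot_noise M X \<xi> X' \<xi>'"
    and "AE \<omega> in M. 0 \<le> \<xi> \<omega>"
    and "a > 0"
  shows "((\<integral>\<^sup>+ \<omega>. exp_ennreal (ennreal a * shot_noise X' \<xi>' t \<omega>) \<partial>M) < \<infinity> \<longleftrightarrow>
        r_fun M X \<xi>' a t < \<infinity> \<and> l_fun M X' \<xi>' a t < \<infinity>) \<and>
      (r_fun M X \<xi>' a t < \<infinity> \<longrightarrow>
        (\<exists>t\<^sub>0\<le>t. (\<integral>\<^sup>+ \<omega>. exp_ennreal (ennreal a * shot_noise X' \<xi>' t\<^sub>0 \<omega>) \<partial>M) < \<infinity>))"
proof -
  interpret renewal_shot_noise M X \<xi> X' \<xi>' by fact
  interpret nonneg_shot_noise M X \<xi> X' \<xi>' a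
    by unfold_locales fact+
  show ?thesis
    unfolding nn_integral_exp_shot_noise
  proof (intro conjI impI)
    show "mult.total_moment t < \<infinity> \<longleftrightarrow> r_fun M X \<xi>' a t < \<infinity> \<and> l_fun M X' \<xi>' a t < \<infinity>"
      by (rule exp_moment_finite_iff)
    assume "r_fun M X \<xi>' a t < \<infinity>"
    then obtain t\<^sub>0 where "t\<^sub>0 \<le> t" "mult.total_moment t\<^sub>0 < \<infinity>"
      by (rule exp_moment_finite_below)
    then show "\<exists>t\<^sub>0\<le>t. mult.total_moment t\<^sub>0 < \<infinity>" by blast
  qed
qed

end
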